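(* Let $L:\mathcal{D}\to\mathbb{R}$ and $C\in\mathbb{R}$, and consider the expected loss notion of validity given, for every family of tests $\psi$ with $\psi(\alpha):\mathcal{X}\to\{n_\alpha,d_\alpha\}$, $\alpha\in(0,1)$, and every data-dependent level $\widetilde{\alpha}$, by $$\psi \text{ is valid for } \widetilde{\alpha}\iff \mathbb{E}^P[L(\psi(\widetilde{\alpha}))]\le C .$$ Assume this notion of validity nests classical validity and preserves classical validity. Then all non-rejections have the same loss: $$L(n_\alpha)=L(n_\beta)\qquad\text{for every }\alpha,\beta\in(0,1).$$
   Context: Setting. $\mathcal{X}$ is the sample space, equipped with a probability distribution $P$ (the simple null hypothesis). External randomization is available throughout: the probability space may be enriched, whenever needed, with a random variable $U\sim\mathrm{Unif}[0,1]$ independent of any other random variables being considered (in particular, there are events of every probability $p\in[0,1]$). All maps whose probabilities or expectations are considered are assumed measurable, and validity is considered for pairs $(\psi,\widetilde{\alpha})$ for which the expectation exists. $\mathcal{D}$ is a totally ordered decision space containing, for each $\alpha\in(0,1)$, an element $d_\alpha$ (the decision to reject at level $\alpha$) and an element $n_\alpha$ (the decision not to reject at level $\alpha$), such that $d_{\alpha^+}\le d_{\alpha^-}$ whenever $\alpha^-\le\alpha^+$, and $n_\beta<d_\alpha$ for all $\alpha,\beta\in(0,1)$. A family of tests $\psi$ is a collection of random variables $\psi(\alpha):\mathcal{X}\to\{n_\alpha,d_\alpha\}$, $\alpha\in(0,1)$. A data-dependent level is a random variable $\widetilde{\alpha}:\mathcal{X}\to(0,1)$, and $\psi(\widetilde{\alpha})$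 denotes the map $x\mapsto\psi(\widetilde{\alpha}(x))(x)$. (Nesting classical validity) for every $\alpha\in(0,1)$ and every $\psi$: $\psi$ is valid for the constant level $\widetilde{\alpha}\equiv\alpha$ if and only if $P(\psi(\alpha)=d_\alpha)\le\alpha$. (Preserving classical validity) for all $\psi,\widetilde{\alpha}$: if $\psi$ is valid for $\widetilde{\alpha}$, then $P(\psi(\widetilde{\alpha})\ge d_\alpha)\le\alpha$ for every $\alpha\in(0,1)$. *)

theory Defs
  imports "HOL-Probability.Probability"
begin

text \<open>
  The decision space is the whole linearly ordered type \<open>'d\<close>; \<open>n \<alpha>\<close> and \<open>d \<alpha>\<close> are only
  constrained for \<open>0 < \<alpha> < 1\<close>.
\<close>

definition decision_space :: "(real \<Rightarrow> 'd::linorder) \<Rightarrow> (real \<Rightarrow> 'd) \<Rightarrow> bool" where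
  "decision_space n d \<longleftrightarrow>
     (\<forall>\<alpha>\<in>{0<..<1}. \<forall>\<beta>\<in>{0<..<1}. \<alpha> \<le> \<beta> \<longrightarrow> d \<beta> \<le> d \<alpha>) \<and>
     (\<forall>\<alpha>\<in>{0<..<1}. \<forall>\<beta>\<in>{0<..<1}. n \<beta> < d \<alpha>)"

text \<open>
  External randomization: an arbitrary probability space is enriched with an independent
  uniform variable on \<open>[0,1]\<close>, namely the second projection. Tests and levels live on this
  enriched space; non-randomized ones are those that ignore the second coordinate.
\<close>

definition randomized :: "'x measure \<Rightarrow> ('x \<times> real) measure" where
  "randomized P = P \<Otimes>\<^sub>M uniform_measure lborel {0..1}"

definition test_family ::
    "'w measure \<Rightarrow> (real \<Rightarrow> 'd) \<Rightarrow> (real \<Rightarrow> 'd) \<Rightarrow> (real \<Rightarrow> 'w \<Rightarrow> 'd) \<Rightarrow> bool" where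
  "test_family M n d \<psi> \<longleftrightarrow> (\<forall>\<alpha>\<in>{0<..<1}. \<psi> \<alpha> \<in> M \<rightarrow>\<^sub>M count_space {n \<alpha>, d \<alpha>})"

definition data_dependent_level :: "'w measure \<Rightarrow> ('w \<Rightarrow> real) \<Rightarrow> bool" where
  "data_dependent_level M a \<longleftrightarrow> a \<in> borel_measurable M \<and> (\<forall>x\<in>space M. a x \<in> {0<..<1})"

definition test_at :: "(real \<Rightarrow> 'w \<Rightarrow> 'd) \<Rightarrow> ('w \<Rightarrow> real) \<Rightarrow> 'w \<Rightarrow> 'd" where
  "test_at \<psi> a x = \<psi> (a x) x"

text \<open>
  Integrability is explicit because the Bochner integral of a non-integrable function is \<open>0\<close>.
  At a constant level the loss takes at most two values, so there it holds automatically.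
\<close>

definition expected_loss_valid ::
    "'w measure \<Rightarrow> ('d \<Rightarrow> real) \<Rightarrow> real \<Rightarrow> (real \<Rightarrow> 'w \<Rightarrow> 'd) \<Rightarrow> ('w \<Rightarrow> real) \<Rightarrow> bool" where
  "expected_loss_valid M L C \<psi> a \<longleftrightarrow>
     integrable M (\<lambda>x. L (test_at \<psi> a x)) \<and> (\<integral>x. L (test_at \<psi> a x) \<partial>M) \<le> C"

definition nests_classical ::
    "'w measure \<Rightarrow> (real \<Rightarrow> 'd) \<Rightarrow> (real \<Rightarrow> 'd) \<Rightarrow>
     ((real \<Rightarrow> 'w \<Rightarrow> 'd) \<Rightarrow> ('w \<Rightarrow> real) \<Rightarrow> bool) \<Rightarrow> bool" where
  "nests_classical M n d valid \<longleftrightarrow>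
     (\<forall>\<alpha>\<in>{0<..<1}. \<forall>\<psi>. test_family M n d \<psi> \<longrightarrow>
        (valid \<psi> (\<lambda>_. \<alpha>) \<longleftrightarrow> measure M {x \<in> space M. \<psi> \<alpha> x = d \<alpha>} \<le> \<alpha>))"

text \<open>
  No \<open>\<sigma>\<close>-algebra on the decision space is given, and \<open>test_at \<psi> a\<close> may select from
  uncountably many tests, so measurability of the rejection events is required of the pair.
\<close>

definition preserves_classical ::
    "'w measure \<Rightarrow> (real \<Rightarrow> 'd::linorder) \<Rightarrow> (real \<Rightarrow> 'd) \<Rightarrow>
     ((real \<Rightarrow> 'w \<Rightarrow> 'd) \<Rightarrow> ('w \<Rightarrow> real) \<Rightarrow> bool) \<Rightarrow> bool" where
  "preserves_classical M n d valid \<longleftrightarrow>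
     (\<forall>\<psi> a. test_family M n d \<psi> \<longrightarrow> data_dependent_level M a \<longrightarrow>
        (\<forall>\<alpha>\<in>{0<..<1}. {x \<in> space M. d \<alpha> \<le> test_at \<psi> a x} \<in> sets M) \<longrightarrow>
        valid \<psi> a \<longrightarrow>
        (\<forall>\<alpha>\<in>{0<..<1}. measure M {x \<in> space M. d \<alpha> \<le> test_at \<psi> a x} \<le> \<alpha>))"

end

theory Submission
  imports Defs
begin

text \<open>
  Suppose \<open>L (n \<delta>) < L (n \<gamma>)\<close>. Consider the test that rejects with probability \<open>p\<close>, at the
  constant level \<open>\<gamma>\<close> and at the level that is \<open>\<gamma>\<close> upon rejection and \<open>\<delta>\<close> otherwise. At level \<open>\<gamma>\<close>
  the test is valid for \<open>p = \<gamma>\<close> and invalid for \<open>p = 1\<close>. At the data-dependent level its expected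
  loss \<open>p L (d \<gamma>) + (1 - p) L (n \<delta>)\<close> is therefore less than \<open>C\<close> at \<open>p = \<gamma>\<close> and greater than \<open>C\<close> at
  \<open>p = 1\<close>, so it equals \<open>C\<close> for some \<open>p > \<gamma>\<close>. For this \<open>p\<close> the pair is valid although it rejects
  at level \<open>\<gamma>\<close> with probability \<open>p > \<gamma>\<close>, contradicting the preservation of classical validity.
\<close>

text \<open>One event \<open>A\<close> decides rejection at all levels simultaneously, so the
  outcome on \<open>A\<close> is known whichever level is selected there.\<close>

definition reject_on :: "'w set \<Rightarrow> (real \<Rightarrow> 'd) \<Rightarrow> (real \<Rightarrow> 'd) \<Rightarrow> real \<Rightarrow> 'w \<Rightarrow> 'd" where
  "reject_on A n d \<alpha> x = (if x \<in> A then d \<alpha> else n \<alpha>)"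

definition level_on :: "'w set \<Rightarrow> real \<Rightarrow> real \<Rightarrow> 'w \<Rightarrow> real" where
  "level_on A \<gamma> \<delta> x = (if x \<in> A then \<gamma> else \<delta>)"

lemma test_at_reject_on:
  "test_at (reject_on A n d) (level_on A \<gamma> \<delta>) x = (if x \<in> A then d \<gamma> else n \<delta>)"
  by (simp add: test_at_def reject_on_def level_on_def)

lemma level_on_same: "level_on A \<gamma> \<gamma> = (\<lambda>_. \<gamma>)"
  by (simp add: level_on_def fun_eq_iff)

lemma test_family_reject_on:
  assumes "A \<in> sets M"
  shows "test_family M n d (reject_on A n d)"
  unfolding test_family_def reject_on_def
  using assms by (auto intro!: measurable_If_set)

lemma data_dependent_level_level_on:
  assumes "A \<in> sets M" "\<gamma> \<in> {0<..<1}" "\<delta> \<in> {0<..<1}"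
  shows "data_dependent_level M (level_on A \<gamma> \<delta>)"
  unfolding data_dependent_level_def level_on_def
  using assms by (auto intro!: measurable_If_set)

text \<open>The loss is an affine function of the indicator of \<open>A\<close>, hence integrable,
  and validity depends on \<open>A\<close> only through \<open>prob A\<close>.\<close>

lemma (in prob_space) expected_loss_valid_reject_on_iff:
  fixes L :: "'d \<Rightarrow> real"
  assumes A: "A \<in> sets M"
  shows "expected_loss_valid M L C (reject_on A n d) (level_on A \<gamma> \<delta>) \<longleftrightarrow>
           prob A * L (d \<gamma>) + (1 - prob A) * L (n \<delta>) \<le> C"
proof -
  have eq: "L (test_at (reject_on A n d) (level_on A \<gamma> \<delta>) x) =
      L (n \<delta>) + indicator A x * (L (d \<gamma>) - L (n \<delta>))" for x
    by (simp add: test_at_reject_on indicator_def)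
  have int: "integrable M (\<lambda>x. indicator A x * (L (d \<gamma>) - L (n \<delta>)))"
    using A by (intro integrable_mult_left integrable_real_indicator) (auto simp: emeasure_eq_measure)
  have "(\<integral>x. L (n \<delta>) + indicator A x * (L (d \<gamma>) - L (n \<delta>)) \<partial>M) =
      L (n \<delta>) + prob A * (L (d \<gamma>) - L (n \<delta>))"
    using A int by (simp add: prob_space Int_absorb2[OF sets.sets_into_space])
  also have "\<dots> = prob A * L (d \<gamma>) + (1 - prob A) * L (n \<delta>)"
    by (simp add: algebra_simps)
  finally show ?thesis
    unfolding expected_loss_valid_def eq using int by simp
qed

lemma (in prob_space) nests_classical_expected_loss_iff:
  assumes ds: "decision_space n d"
    and nest: "nests_classical M n d (expected_loss_valid M L C)"
    and A: "A \<in> sets M" and \<gamma>: "\<gamma> \<in> {0<..<1}"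
  shows "prob A * L (d \<gamma>) + (1 - prob A) * L (n \<gamma>) \<le> C \<longleftrightarrow> prob A \<le> \<gamma>"
proof -
  \<comment> \<open>Distinct decisions make the rejection event exactly \<open>A\<close>.\<close>
  have "n \<gamma> \<noteq> d \<gamma>"
    using ds \<gamma> unfolding decision_space_def by fastforce
  then have "{x \<in> space M. reject_on A n d \<gamma> x = d \<gamma>} = A"
    using sets.sets_into_space[OF A] by (auto simp: reject_on_def)
  then show ?thesis
    using nest \<gamma> test_family_reject_on[OF A] expected_loss_valid_reject_on_iff[OF A, of L C n d \<gamma> \<gamma>]
    unfolding nests_classical_def level_on_same by metis
qed

lemma (in prob_space) preserves_classical_expected_lossD:
  assumes ds: "decision_space n d"
    and pres: "preserves_classical M n d (expected_loss_valid M L C)"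
    and A: "A \<in> sets M" and \<gamma>: "\<gamma> \<in> {0<..<1}" and \<delta>: "\<delta> \<in> {0<..<1}"
    and loss: "prob A * L (d \<gamma>) + (1 - prob A) * L (n \<delta>) \<le> C"
  shows "prob A \<le> \<gamma>"
proof -
  \<comment> \<open>Outside \<open>A\<close> the decision \<open>n \<delta>\<close> lies below every
    \<open>d \<alpha>\<close>; on \<open>A\<close> the decision is the constant
    \<open>d \<gamma>\<close>. This also settles measurability.\<close>
  have rej: "{x \<in> space M. d \<alpha> \<le> test_at (reject_on A n d) (level_on A \<gamma> \<delta>) x} =
      (if d \<alpha> \<le> d \<gamma> then A else {})" if "\<alpha> \<in> {0<..<1}" for \<alpha>
  proof -
    have "n \<delta> < d \<alpha>"
      using ds \<delta> that unfolding decision_space_def by blast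
    then show ?thesis
      using sets.sets_into_space[OF A] by (auto simp: test_at_reject_on)
  qed
  have "\<forall>\<alpha>\<in>{0<..<1}.
      {x \<in> space M. d \<alpha> \<le> test_at (reject_on A n d) (level_on A \<gamma> \<delta>) x} \<in> sets M"
    using A rej by simp
  then have "measure M {x \<in> space M. d \<gamma> \<le> test_at (reject_on A n d) (level_on A \<gamma> \<delta>) x} \<le> \<gamma>"
    using pres test_family_reject_on[OF A] data_dependent_level_level_on[OF A \<gamma> \<delta>] loss \<gamma>
    unfolding preserves_classical_def expected_loss_valid_reject_on_iff[OF A, symmetric] by blast
  then show ?thesis
    using rej[OF \<gamma>] by simp
qed

lemma (in prob_space) nonrejection_loss_le:
  assumes events: "\<And>p. p \<in> {0..1} \<Longrightarrow> \<exists>A\<in>sets M. prob A = p"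
    and ds: "decision_space n d"
    and nest: "nests_classical M n d (expected_loss_valid M L C)"
    and pres: "preserves_classical M n d (expected_loss_valid M L C)"
    and \<gamma>: "\<gamma> \<in> {0<..<1}" and \<delta>: "\<delta> \<in> {0<..<1}"
  shows "L (n \<gamma>) \<le> L (n \<delta>)"
proof (rule ccontr)
  assume "\<not> L (n \<gamma>) \<le> L (n \<delta>)"
  then have less: "L (n \<delta>) < L (n \<gamma>)"
    by simp
  have "\<gamma> * L (d \<gamma>) + (1 - \<gamma>) * L (n \<gamma>) \<le> C"
    using events[of \<gamma>] nests_classical_expected_loss_iff[OF ds nest _ \<gamma>] \<gamma> by fastforce
  moreover have "(1 - \<gamma>) * L (n \<delta>) < (1 - \<gamma>) * L (n \<gamma>)"
    using less \<gamma> by simp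
  ultimately have lower: "\<gamma> * L (d \<gamma>) + (1 - \<gamma>) * L (n \<delta>) < C"
    by linarith
  \<comment> \<open>Always rejecting, with \<open>A\<close> the whole space, has probability
    \<open>1 > \<gamma>\<close> and so is invalid at level \<open>\<gamma>\<close>.\<close>
  have upper: "C < L (d \<gamma>)"
    using nests_classical_expected_loss_iff[OF ds nest sets.top \<gamma>] \<gamma> by (simp add: prob_space)
  have "(1 - \<gamma>) * L (n \<delta>) < (1 - \<gamma>) * L (d \<gamma>)"
    using lower upper by (simp add: algebra_simps)
  then have gap: "L (n \<delta>) < L (d \<gamma>)"
    using \<gamma> by simp
  \<comment> \<open>The solution of
    \<open>p * L (d \<gamma>) + (1 - p) * L (n \<delta>) = C\<close>; \<open>lower\<close> places it
    above \<open>\<gamma>\<close> and \<open>upper\<close> below \<open>1\<close>.\<close>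
  define p where "p = (C - L (n \<delta>)) / (L (d \<gamma>) - L (n \<delta>))"
  have p: "\<gamma> < p" "p < 1"
    using lower upper gap by (simp_all add: p_def field_simps)
  have "p * (L (d \<gamma>) - L (n \<delta>)) = C - L (n \<delta>)"
    using gap by (simp add: p_def)
  then have loss: "p * L (d \<gamma>) + (1 - p) * L (n \<delta>) \<le> C"
    by (simp add: algebra_simps)
  obtain A where "A \<in> sets M" "prob A = p"
    using events[of p] p \<gamma> by auto
  then have "p \<le> \<gamma>"
    using preserves_classical_expected_lossD[OF ds pres _ \<gamma> \<delta>] loss by blast
  then show False
    using p by simp
qed

lemma prob_space_randomized:
  assumes "prob_space P"
  shows "prob_space (randomized P)"
proof -
  interpret P: prob_space P by fact
  interpret U: prob_space "uniform_measure lborel {0..1::real}"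
    by (rule prob_space_uniform_measure) auto
  interpret PU: pair_prob_space P "uniform_measure lborel {0..1::real}" ..
  show ?thesis
    unfolding randomized_def by (rule PU.prob_space_axioms)
qed

text \<open>The event that the uniform coordinate is at most \<open>p\<close> has probability
  \<open>p\<close>, even if \<open>P\<close> itself has atoms.\<close>

lemma randomized_event_exists:
  assumes "prob_space P" "p \<in> {0..1}"
  shows "\<exists>A\<in>sets (randomized P). measure (randomized P) A = p"
proof -
  interpret P: prob_space P by fact
  interpret U: prob_space "uniform_measure lborel {0..1::real}"
    by (rule prob_space_uniform_measure) auto
  have "{0..1} \<inter> {0..p} = {0..p}"
    using assms(2) by auto
  then have "emeasure (uniform_measure lborel {0..1}) {0..p} = ennreal p"
    using assms(2) by (simp add: divide_ennreal_def)
  then have "emeasure (randomized P) (space P \<times> {0..p}) = ennreal p"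
    unfolding randomized_def
    by (subst U.emeasure_pair_measure_Times) (simp_all add: P.emeasure_space_1)
  then have "measure (randomized P) (space P \<times> {0..p}) = p"
    using assms(2) by (simp add: measure_def)
  moreover have "space P \<times> {0..p} \<in> sets (randomized P)"
    unfolding randomized_def by (intro pair_measureI) auto
  ultimately show ?thesis
    by blast
qed

theorem proposition9:
  fixes P :: "'x measure"
    and n d :: "real \<Rightarrow> 'd::linorder"
    and L :: "'d \<Rightarrow> real"
    and C :: real
  assumes "prob_space P"
    and "decision_space n d"
    and "nests_classical (randomized P) n d (expected_loss_valid (randomized P) L C)"
    and "preserves_classical (randomized P) n d (expected_loss_valid (randomized P) L C)"
  shows "\<forall>\<alpha>\<in>{0<..<1}. \<forall>\<beta>\<in>{0<..<1}. L (n \<alpha>) = L (n \<beta>)"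
proof -
  have "L (n \<alpha>) \<le> L (n \<beta>)" if "\<alpha> \<in> {0<..<1}" "\<beta> \<in> {0<..<1}" for \<alpha> \<beta>
    using prob_space.nonrejection_loss_le[OF prob_space_randomized[OF assms(1)]
        randomized_event_exists[OF assms(1)] assms(2-4) that] .
  \<comment> \<open>The inequality holds for both orders of the two levels.\<close>
  then show ?thesis
    by (blast intro: antisym)
qed

end
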